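(* Let $G,I,J,L,M,N,P,Q,R,S$ be complex numbers and put $$\begin{aligned} A&=I+2L+2N+P+2Q+6R+4S-14,\\ C&=-G-I-J-2L-M-2P-3Q-6R-7S+20,\\ E&=-I-2L-N-Q-3R-S+5,\\ F&=3G-J-M+6N+3P+3Q+12R+9S-30,\\ H&=-L-2N-P-Q-4R-3S+10,\\ K&=-2G-2M-2N-5P-2Q-6R-12S+30, \end{aligned}$$ and assume $C\ne0$. Then for all integers $m\ge0$ and $n\ge1$, $$\begin{aligned} C\,t_{4,m}^{(n)}&=\frac1{(A_1^{(n)})^5}\sum_{k_1+\cdots+k_5=m}\binom{m}{k_1,\dots,k_5}U_{k_1}^{(n)}\cdots U_{k_5}^{(n)}\\ &\quad-\frac{A}{A_1^{(5n)}}5^mU_m^{(5n)}-\frac{E}{A_1^{(4n)}A_1^{(n)}}\sum_{k=0}^m\binom mk4^{m-k}U_{m-k}^{(4n)}U_k^{(n)}-F\left(\frac{-1}{563}\right)^n\sum_{k=0}^m\binom mkU_k^{(n)}\\ &\quad-\frac{G}{A_1^{(n)}}\sum_{k=0}^m\binom mkt_{2,k}^{(n)}U_{m-k}^{(n)}-\frac{H}{A_1^{(3n)}A_1^{(2n)}}\sum_{k=0}^m\binom mk3^{m-k}2^kU_{m-k}^{(3n)}U_k^{(2n)}\\ &\quad-\frac{I}{A_1^{(3n)}}\sum_{k=0}^m\binom mk3^kU_k^{(3n)}t_{1,m-k}^{(n)}\\ &\quad-\frac{J}{A_2^{(n)}A_1^{(2n)}}\sum_{k_1+k_2+k_3=m}\binom{m}{k_1,k_2,k_3}(-1)^{k_1}V_{k_1}^{(n)}2^{k_2}U_{k_2}^{(2n)}\\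 &\quad-\frac{K}{A_2^{(n)}}\sum_{k_1+k_2+k_3=m}\binom{m}{k_1,k_2,k_3}(-1)^{k_1}V_{k_1}^{(n)}t_{1,k_2}^{(n)}\\ &\quad-\frac{L}{A_1^{(3n)}(A_1^{(n)})^2}\sum_{k_1+k_2+k_3=m}\binom{m}{k_1,k_2,k_3}3^{k_1}U_{k_1}^{(3n)}U_{k_2}^{(n)}U_{k_3}^{(n)}\\ &\quad-\frac{M}{A_2^{(n)}(A_1^{(n)})^2}\sum_{k_1+k_2+k_3+k_4=m}\binom{m}{k_1,k_2,k_3,k_4}(-1)^{k_1}V_{k_1}^{(n)}U_{k_2}^{(n)}U_{k_3}^{(n)}\\ &\quad-\frac{N}{(A_1^{(2n)})^2A_1^{(n)}}\sum_{k_1+k_2+k_3=m}\binom{m}{k_1,k_2,k_3}2^{k_1}U_{k_1}^{(2n)}2^{k_2}U_{k_2}^{(2n)}U_{k_3}^{(n)}\\ &\quad-\frac{P}{A_1^{(n)}}\sum_{k_1+k_2+k_3=m}\binom{m}{k_1,k_2,k_3}t_{1,k_1}^{(n)}t_{1,k_2}^{(n)}U_{k_3}^{(n)}\\ &\quad-\frac{Q}{A_1^{(2n)}A_1^{(n)}}\sum_{k_1+k_2+k_3=m}\binom{m}{k_1,k_2,k_3}2^{k_1}U_{k_1}^{(2n)}t_{1,k_2}^{(n)}U_{k_3}^{(n)}\\ &\quad-\frac{R}{A_1^{(2n)}(A_1^{(n)})^3}\sum_{k_1+k_2+k_3+k_4=m}\binom{m}{k_1,k_2,k_3,k_4}2^{k_1}U_{k_1}^{(2n)}U_{k_2}^{(n)}U_{k_3}^{(n)}U_{k_4}^{(n)}\\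 &\quad-\frac{S}{(A_1^{(n)})^3}\sum_{k_1+k_2+k_3+k_4=m}\binom{m}{k_1,k_2,k_3,k_4}t_{1,k_1}^{(n)}U_{k_2}^{(n)}U_{k_3}^{(n)}U_{k_4}^{(n)}. \end{aligned}$$
   Context: Let $\lambda_1,\lambda_2,\lambda_3,\lambda_4$ be the (distinct, complex) roots of $x^4-x^3-x^2-x-1=0$ and $c_i=\frac1{-\lambda_i^3+6\lambda_i-1}$. A Tetranacci-type sequence is one in which, from index $4$ on, each term is the sum of the four preceding terms. For each $n\ge1$, let $A_1^{(n)}$ be the nonzero rational number and $U_k^{(n)}=T_{1,k}^{(s_{1,0}^{(n)},s_{1,1}^{(n)},s_{1,2}^{(n)},s_{1,3}^{(n)})}$ the Tetranacci-type sequence with integer initial values $U_j^{(n)}=s_{1,j}^{(n)}$ ($0\le j\le3$) of greatest common divisor $1$ such that $$\sum_{i=1}^4c_i^ne^{\lambda_ix}=\frac1{A_1^{(n)}}\sum_{k=0}^\infty U_k^{(n)}\frac{x^k}{k!}.$$ Likewise let $A_2^{(n)}$ be the nonzero rational number and $V_k^{(n)}=T_{2,k}^{(s_{2,0}^{(n)},s_{2,1}^{(n)},s_{2,2}^{(n)},s_{2,3}^{(n)})}$ the Tetranacci-type sequence with integer initial values $V_j^{(n)}=s_{2,j}^{(n)}$ ($0\le j\le3$) of greatest common divisor $1$ such that $$\sum_{i=1}^4\Big(\prod_{j\ne i}c_j^n\Big)e^{\lambda_ix}=\frac1{A_2^{(n)}}\sum_{k=0}^\infty V_k^{(n)}\frac{x^k}{k!}.$$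 The signs are fixed by requiring $U_k^{(n)}>0$ and $V_k^{(n)}>0$ for all sufficiently large $k$. Put $$t_{1,m}^{(n)}=\frac12\left(\frac1{(A_1^{(n)})^2}\sum_{k=0}^m\binom mkU_k^{(n)}U_{m-k}^{(n)}-\frac{2^m}{A_1^{(2n)}}U_m^{(2n)}\right),$$ equivalently $\sum_{m\ge0}t_{1,m}^{(n)}\frac{x^m}{m!}=\sum_{1\le i<j\le4}c_i^nc_j^ne^{(\lambda_i+\lambda_j)x}$, and define $t_{2,m}^{(n)}$, $t_{4,m}^{(n)}$ by $$\sum_{m=0}^\infty t_{2,m}^{(n)}\frac{x^m}{m!}=\sum_{1\le i<j<l\le4}c_i^nc_j^nc_l^ne^{(\lambda_i+\lambda_j+\lambda_l)x}\left(c_i^ne^{\lambda_ix}+c_j^ne^{\lambda_jx}+c_l^ne^{\lambda_lx}\right),$$ $$\sum_{m=0}^\infty t_{4,m}^{(n)}\frac{x^m}{m!}=\sum_{1\le i<j<l\le4}c_i^nc_j^nc_l^ne^{(\lambda_i+\lambda_j+\lambda_l)x}\left(c_i^{2n}e^{2\lambda_ix}+c_j^{2n}e^{2\lambda_jx}+c_l^{2n}e^{2\lambda_lx}\right).$$ Superscripts $(n)$ are indices; $c_i^n$ is an $n$-th power. All indices $k_i$ run over nonnegative integers and $\binom{m}{k_1,\dots,k_r}=\frac{m!}{k_1!\cdots k_r!}$.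
   Formalization: The term with coefficient F is taken with the factor 1/A_1^{(n)}, which the printed formula lacks; without it the identity fails, e.g. for n=2, m=0 and all parameters zero, where A_1^{(2)} is not 1 and U_0^{(2)} is nonzero. *)

theory Defs
  imports Complex_Main "HOL-Computational_Algebra.Formal_Power_Series"
begin

definition tetra_coeff :: "complex \<Rightarrow> complex" where
  "tetra_coeff z = 1 / (- (z ^ 3) + 6 * z - 1)"

definition tetranacci_type :: "(nat \<Rightarrow> int) \<Rightarrow> bool" where
  "tetranacci_type u \<longleftrightarrow> (\<forall>k. u (k + 4) = u (k + 3) + u (k + 2) + u (k + 1) + u k)"

definition egf :: "(nat \<Rightarrow> complex) \<Rightarrow> complex fps" where
  "egf u = Abs_fps (\<lambda>k. u k / fact k)"

definition egf_coeff :: "complex fps \<Rightarrow> nat \<Rightarrow> complex" where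
  "egf_coeff f m = fact m * fps_nth f m"

text \<open>The pair \<open>(A, u)\<close> is the normalised representation \<open>f = (1 / A) \<Sum> u\<^sub>k x\<^sup>k / k!\<close>:
  the gcd condition determines \<open>(A, u)\<close> up to sign, and eventual positivity fixes the sign.\<close>

definition tetranacci_rep :: "complex fps \<Rightarrow> rat \<Rightarrow> (nat \<Rightarrow> int) \<Rightarrow> bool" where
  "tetranacci_rep f A u \<longleftrightarrow>
     A \<noteq> 0 \<and> tetranacci_type u \<and> Gcd {u 0, u 1, u 2, u 3} = 1 \<and>
     (\<forall>\<^sub>F k in sequentially. u k > 0) \<and>
     f = fps_const (1 / of_rat A) * egf (\<lambda>k. of_int (u k))"

definition U_egf :: "(nat \<Rightarrow> complex) \<Rightarrow> nat \<Rightarrow> complex fps" where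
  "U_egf lam n = (\<Sum>i=1..4. fps_const (tetra_coeff (lam i) ^ n) * fps_exp (lam i))"

definition V_egf :: "(nat \<Rightarrow> complex) \<Rightarrow> nat \<Rightarrow> complex fps" where
  "V_egf lam n =
     (\<Sum>i=1..4. fps_const (\<Prod>j\<in>{1..4} - {i}. tetra_coeff (lam j) ^ n) * fps_exp (lam i))"

definition t1 :: "(nat \<Rightarrow> rat) \<Rightarrow> (nat \<Rightarrow> nat \<Rightarrow> int) \<Rightarrow> nat \<Rightarrow> nat \<Rightarrow> complex" where
  "t1 A1 U n m =
     1 / 2 * (1 / of_rat (A1 n) ^ 2
                * (\<Sum>k=0..m. of_nat (m choose k) * of_int (U n k) * of_int (U n (m - k)))
              - 2 ^ m / of_rat (A1 (2 * n)) * of_int (U (2 * n) m))"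

definition triples :: "(nat \<times> nat \<times> nat) set" where
  "triples = {(i, j, l). 1 \<le> i \<and> i < j \<and> j < l \<and> l \<le> 4}"

definition t2 :: "(nat \<Rightarrow> complex) \<Rightarrow> nat \<Rightarrow> nat \<Rightarrow> complex" where
  "t2 lam n =
     (let c = (\<lambda>i. tetra_coeff (lam i)) in
      egf_coeff (\<Sum>(i, j, l)\<in>triples.
        fps_const (c i ^ n * c j ^ n * c l ^ n) * fps_exp (lam i + lam j + lam l) *
        (fps_const (c i ^ n) * fps_exp (lam i) +
         fps_const (c j ^ n) * fps_exp (lam j) +
         fps_const (c l ^ n) * fps_exp (lam l))))"

definition t4 :: "(nat \<Rightarrow> complex) \<Rightarrow> nat \<Rightarrow> nat \<Rightarrow> complex" where
  "t4 lam n =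
     (let c = (\<lambda>i. tetra_coeff (lam i)) in
      egf_coeff (\<Sum>(i, j, l)\<in>triples.
        fps_const (c i ^ n * c j ^ n * c l ^ n) * fps_exp (lam i + lam j + lam l) *
        (fps_const (c i ^ (2 * n)) * fps_exp (2 * lam i) +
         fps_const (c j ^ (2 * n)) * fps_exp (2 * lam j) +
         fps_const (c l ^ (2 * n)) * fps_exp (2 * lam l))))"

definition multinom :: "nat \<Rightarrow> nat list \<Rightarrow> complex" where
  "multinom m ks = fact m / (\<Prod>k\<leftarrow>ks. fact k)"

end

theory Submission
  imports Defs
begin

text \<open>
  Put \<open>x\<^sub>i = c\<^sub>i\<^sup>n exp (\<lambda>\<^sub>i X)\<close> for \<open>i = 1, \<dots>, 4\<close>. Every sequence in the theorem
  consists of the coefficients of a symmetric function of these four formal power series, so the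
  whole formula is one identity between symmetric polynomials of degree \<open>5\<close> in four variables,
  read off coefficient by coefficient:

  \<^item> \<open>r\<^sup>k U\<^sub>k / A\<^sub>1\<close>, with upper index \<open>r n\<close>, belongs to the power sum \<open>p\<^sub>r\<close>, because
    \<open>x\<^sub>i\<^sup>r = c\<^sub>i\<^bsup>rn\<^esup> exp (r \<lambda>\<^sub>i X)\<close> (\<open>egf_coeff_psum_exp_term\<close>);
  \<^item> the sequence \<open>t\<^sub>1\<close> belongs to \<open>e\<^sub>2 = (p\<^sub>1\<^sup>2 - p\<^sub>2) / 2\<close>;
  \<^item> \<open>(-1)\<^sup>k V\<^sub>k / A\<^sub>2\<close>, convolved with the constant sequence \<open>1\<close>, belongs to \<open>e\<^sub>3\<close>:
    the roots have sum \<open>1\<close>, so three of them add up to \<open>1\<close> minus the fourth (\<open>esym3_exp_term\<close>);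
  \<^item> \<open>e\<^sub>4\<close> is \<open>(-1/563)\<^sup>n exp X\<close>, because the coefficients \<open>c\<^sub>i\<close> have product \<open>-1/563\<close>
    (\<open>prod_tetra_coeff\<close>, \<open>esym4_exp_term\<close>);
  \<^item> \<open>t\<^sub>2\<close> and \<open>t\<^sub>4\<close> belong to the monomial symmetric functions \<open>m\<^sub>2\<^sub>1\<^sub>1\<close> and \<open>m\<^sub>3\<^sub>1\<^sub>1\<close>.

  Symmetric polynomials of degree \<open>5\<close> in four variables form a space of dimension \<open>6\<close>, with basis
  \<open>p\<^sub>5\<close>, \<open>p\<^sub>4 p\<^sub>1\<close>, \<open>p\<^sub>3 p\<^sub>2\<close>, \<open>m\<^sub>3\<^sub>1\<^sub>1\<close>, \<open>e\<^sub>3 e\<^sub>2\<close> and \<open>e\<^sub>4 p\<^sub>1\<close>. Therefore \<open>p\<^sub>1\<^sup>5\<close> minus an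
  arbitrary combination, with coefficients \<open>G, I, J, L, M, N, P, Q, R, S\<close>, of the other products
  can be expanded in this basis, and the formulas for \<open>A, E, H, C, K, F\<close> are the
  coordinates of the expansion (\<open>quintic_symmetric_identity\<close>). A product of exponential generating
  functions has the multinomial convolution of the factors as its coefficients
  (\<open>egf_coeff_mult_2\<close> to \<open>egf_coeff_mult_5\<close>); this turns the identity into the sums of the theorem.
\<close>

section \<open>Multinomial convolution\<close>

lemma egf_coeff_add: "egf_coeff (f + g) m = egf_coeff f m + egf_coeff g m"
  by (simp add: egf_coeff_def algebra_simps)

lemma egf_coeff_diff: "egf_coeff (f - g) m = egf_coeff f m - egf_coeff g m"
  by (simp add: egf_coeff_def algebra_simps)

lemma egf_coeff_const_mult: "egf_coeff (fps_const c * f) m = c * egf_coeff f m"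
  by (simp add: egf_coeff_def)

lemma egf_coeff_sum: "egf_coeff (\<Sum>i\<in>X. f i) m = (\<Sum>i\<in>X. egf_coeff (f i) m)"
  by (simp add: egf_coeff_def fps_sum_nth sum_distrib_left)

lemma egf_coeff_exp: "egf_coeff (fps_exp z) m = z ^ m"
  by (simp add: egf_coeff_def)

lemma egf_coeff_egf: "egf_coeff (egf u) m = u m"
  by (simp add: egf_coeff_def egf_def)

text \<open>
  One convolution step. The indices of the factors already multiplied are packed into a single
  index \<open>x\<close> whose total degree is \<open>w x\<close>; iterating the step gives sums over tuples of any
  length.
\<close>

lemma fps_mult_nth_weighted:
  fixes f F :: "complex fps" and w :: "'a \<Rightarrow> nat"
  assumes fin: "\<And>m. finite {x. w x = m}"
    and F: "\<And>m. fps_nth F m = (\<Sum>x | w x = m. g x)"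
  shows "fps_nth (f * F) m = (\<Sum>(k, x) | k + w x = m. fps_nth f k * g x)"
proof -
  have fibres: "{(k, x). k + w x = m} = Sigma {0..m} (\<lambda>k. {x. w x = m - k})"
    by auto
  have "fps_nth (f * F) m = (\<Sum>k=0..m. \<Sum>x | w x = m - k. fps_nth f k * g x)"
    by (simp add: fps_mult_nth F sum_distrib_left)
  also have "\<dots> = (\<Sum>(k, x) | k + w x = m. fps_nth f k * g x)"
    unfolding fibres using fin by (subst sum.Sigma) auto
  finally show ?thesis .
qed

lemma finite_weighted_fibre:
  fixes w :: "'a \<Rightarrow> nat"
  assumes "\<And>m. finite {x. w x = m}"
  shows "finite {(k, x). k + w x = m}"
proof -
  have "{(k, x). k + w x = m} = Sigma {0..m} (\<lambda>k. {x. w x = m - k})"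
    by auto
  then show ?thesis using assms by auto
qed

lemma fps_mult_nth_2:
  fixes f1 f2 :: "complex fps"
  shows "fps_nth (f1 * f2) m = (\<Sum>(k1, k2) | k1 + k2 = m. fps_nth f1 k1 * fps_nth f2 k2)"
  using fps_mult_nth_weighted[where w = "\<lambda>k. k" and F = f2 and g = "fps_nth f2"]
  by simp

lemma finite_fibre_2: "finite {(k1, k2). k1 + k2 = (m :: nat)}"
  using finite_weighted_fibre[where w = "\<lambda>k :: nat. k"] by simp

lemma fps_mult_nth_3:
  fixes f1 f2 f3 :: "complex fps"
  shows "fps_nth (f1 * (f2 * f3)) m =
      (\<Sum>(k1, k2, k3) | k1 + k2 + k3 = m. fps_nth f1 k1 * (fps_nth f2 k2 * fps_nth f3 k3))"
  using fps_mult_nth_weighted[where w = "\<lambda>(k2, k3). k2 + k3" and F = "f2 * f3"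
      and g = "\<lambda>(k2, k3). fps_nth f2 k2 * fps_nth f3 k3", of f1 m]
    fps_mult_nth_2[of f2 f3] finite_fibre_2
  by (simp add: case_prod_unfold add.assoc)

lemma finite_fibre_3: "finite {(k1, k2, k3). k1 + k2 + k3 = (m :: nat)}"
  using finite_weighted_fibre[where w = "\<lambda>(k2, k3). k2 + k3", of m] finite_fibre_2
  by (simp add: case_prod_unfold add.assoc)

lemma fps_mult_nth_4:
  fixes f1 f2 f3 f4 :: "complex fps"
  shows "fps_nth (f1 * (f2 * (f3 * f4))) m =
      (\<Sum>(k1, k2, k3, k4) | k1 + k2 + k3 + k4 = m.
         fps_nth f1 k1 * (fps_nth f2 k2 * (fps_nth f3 k3 * fps_nth f4 k4)))"
  using fps_mult_nth_weighted[where w = "\<lambda>(k2, k3, k4). k2 + k3 + k4" and F = "f2 * (f3 * f4)"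
      and g = "\<lambda>(k2, k3, k4). fps_nth f2 k2 * (fps_nth f3 k3 * fps_nth f4 k4)", of f1 m]
    fps_mult_nth_3[of f2 f3 f4] finite_fibre_3
  by (simp add: case_prod_unfold add.assoc)

lemma finite_fibre_4: "finite {(k1, k2, k3, k4). k1 + k2 + k3 + k4 = (m :: nat)}"
  using finite_weighted_fibre[where w = "\<lambda>(k2, k3, k4). k2 + k3 + k4", of m] finite_fibre_3
  by (simp add: case_prod_unfold add.assoc)

lemma fps_mult_nth_5:
  fixes f1 f2 f3 f4 f5 :: "complex fps"
  shows "fps_nth (f1 * (f2 * (f3 * (f4 * f5)))) m =
      (\<Sum>(k1, k2, k3, k4, k5) | k1 + k2 + k3 + k4 + k5 = m.
         fps_nth f1 k1 * (fps_nth f2 k2 * (fps_nth f3 k3 * (fps_nth f4 k4 * fps_nth f5 k5))))"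
  using fps_mult_nth_weighted[where w = "\<lambda>(k2, k3, k4, k5). k2 + k3 + k4 + k5"
      and F = "f2 * (f3 * (f4 * f5))"
      and g = "\<lambda>(k2, k3, k4, k5). fps_nth f2 k2 * (fps_nth f3 k3 * (fps_nth f4 k4 * fps_nth f5 k5))",
      of f1 m]
    fps_mult_nth_4[of f2 f3 f4 f5] finite_fibre_4
  by (simp add: case_prod_unfold add.assoc)

lemma egf_coeff_mult_2:
  "egf_coeff (f * g) m = (\<Sum>k=0..m. of_nat (m choose k) * egf_coeff f k * egf_coeff g (m - k))"
  unfolding egf_coeff_def fps_mult_nth sum_distrib_left
  by (intro sum.cong refl) (simp add: binomial_fact)

lemma egf_coeff_mult_3:
  "egf_coeff (f1 * (f2 * f3)) m =
     (\<Sum>(k1, k2, k3) | k1 + k2 + k3 = m. multinom m [k1, k2, k3] *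
        egf_coeff f1 k1 * egf_coeff f2 k2 * egf_coeff f3 k3)"
  unfolding egf_coeff_def fps_mult_nth_3 sum_distrib_left multinom_def
  by (intro sum.cong refl) (auto simp: field_simps)

lemma egf_coeff_mult_4:
  "egf_coeff (f1 * (f2 * (f3 * f4))) m =
     (\<Sum>(k1, k2, k3, k4) | k1 + k2 + k3 + k4 = m. multinom m [k1, k2, k3, k4] *
        egf_coeff f1 k1 * egf_coeff f2 k2 * egf_coeff f3 k3 * egf_coeff f4 k4)"
  unfolding egf_coeff_def fps_mult_nth_4 sum_distrib_left multinom_def
  by (intro sum.cong refl) (auto simp: field_simps)

lemma egf_coeff_mult_5:
  "egf_coeff (f1 * (f2 * (f3 * (f4 * f5)))) m =
     (\<Sum>(k1, k2, k3, k4, k5) | k1 + k2 + k3 + k4 + k5 = m. multinom m [k1, k2, k3, k4, k5] *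
        egf_coeff f1 k1 * egf_coeff f2 k2 * egf_coeff f3 k3 * egf_coeff f4 k4 * egf_coeff f5 k5)"
  unfolding egf_coeff_def fps_mult_nth_5 sum_distrib_left multinom_def
  by (intro sum.cong refl) (auto simp: field_simps)

section \<open>Symmetric functions of four elements\<close>

definition psum :: "(nat \<Rightarrow> 'a::comm_ring_1) \<Rightarrow> nat \<Rightarrow> 'a" where
  "psum x r = x 1 ^ r + x 2 ^ r + x 3 ^ r + x 4 ^ r"

definition esym2 :: "(nat \<Rightarrow> 'a::comm_ring_1) \<Rightarrow> 'a" where
  "esym2 x = x 1 * x 2 + x 1 * x 3 + x 1 * x 4 + x 2 * x 3 + x 2 * x 4 + x 3 * x 4"

definition esym3 :: "(nat \<Rightarrow> 'a::comm_ring_1) \<Rightarrow> 'a" where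
  "esym3 x = x 1 * x 2 * x 3 + x 1 * x 2 * x 4 + x 1 * x 3 * x 4 + x 2 * x 3 * x 4"

definition esym4 :: "(nat \<Rightarrow> 'a::comm_ring_1) \<Rightarrow> 'a" where
  "esym4 x = x 1 * x 2 * x 3 * x 4"

text \<open>The monomial symmetric function of the partition \<open>(r + 1, 1, 1)\<close> when \<open>r \<ge> 1\<close>.\<close>

definition triple_sum :: "(nat \<Rightarrow> 'a::comm_ring_1) \<Rightarrow> nat \<Rightarrow> 'a" where
  "triple_sum x r = (\<Sum>(i, j, l)\<in>triples. x i * x j * x l * (x i ^ r + x j ^ r + x l ^ r))"

lemma triples_eq: "triples = {(1, 2, 3), (1, 2, 4), (1, 3, 4), (2, 3, 4)}"
proof -
  have "(i, j, l) \<in> triples \<longleftrightarrow> (i, j, l) \<in> {(1, 2, 3), (1, 2, 4), (1, 3, 4), (2, 3, 4)}"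
    for i j l :: nat
    unfolding triples_def by auto
  then show ?thesis by (intro set_eqI) (metis prod_cases3)
qed

text \<open>Newton's recursion, which makes these power sums polynomials in \<open>p\<^sub>1, e\<^sub>2, e\<^sub>3, e\<^sub>4\<close>.\<close>

lemma newton_psum:
  fixes x :: "nat \<Rightarrow> 'a::comm_ring_1"
  shows "psum x 2 = psum x 1 * psum x 1 - 2 * esym2 x"
    and "psum x 3 = psum x 1 * psum x 2 - esym2 x * psum x 1 + 3 * esym3 x"
    and "psum x 4 = psum x 1 * psum x 3 - esym2 x * psum x 2 + esym3 x * psum x 1 - 4 * esym4 x"
    and "psum x 5 = psum x 1 * psum x 4 - esym2 x * psum x 3 + esym3 x * psum x 2
           - esym4 x * psum x 1"
  unfolding psum_def esym2_def esym3_def esym4_def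
  by (simp_all add: algebra_simps eval_nat_numeral)

text \<open>
  Multiplying \<open>e\<^sub>3\<close> by \<open>p\<^sub>r\<close> either repeats one of the three indices, which gives \<open>triple_sum x r\<close>,
  or brings in the fourth one. Each term of the second kind is \<open>e\<^sub>4\<close> times the \<open>(r - 1)\<close>-st power
  of the index brought in, and for \<open>r = 1\<close> there are four of them.
\<close>

lemma triple_sum_1:
  fixes x :: "nat \<Rightarrow> 'a::comm_ring_1"
  shows "triple_sum x 1 = esym3 x * psum x 1 - 4 * esym4 x"
  unfolding triple_sum_def triples_eq psum_def esym3_def esym4_def
  by (simp add: algebra_simps eval_nat_numeral)

lemma triple_sum_2:
  fixes x :: "nat \<Rightarrow> 'a::comm_ring_1"
  shows "triple_sum x 2 = esym3 x * psum x 2 - esym4 x * psum x 1"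
  unfolding triple_sum_def triples_eq psum_def esym3_def esym4_def
  by (simp add: algebra_simps eval_nat_numeral)

text \<open>
  Expressed through \<open>p\<^sub>1, e\<^sub>2, e\<^sub>3, e\<^sub>4\<close>, both sides are combinations
  of the six monomials of weight \<open>5\<close>: \<open>p\<^sub>1\<^sup>5\<close>, \<open>p\<^sub>1\<^sup>3 e\<^sub>2\<close>, \<open>p\<^sub>1 e\<^sub>2\<^sup>2\<close>, \<open>p\<^sub>1\<^sup>2 e\<^sub>3\<close>, \<open>e\<^sub>2 e\<^sub>3\<close> and
  \<open>p\<^sub>1 e\<^sub>4\<close>. The hypotheses on \<open>A, C, E, F, H, K\<close> solve the linear system that comparison of their
  six coefficients imposes. Products are bracketed to the right, as in the convolution
  lemmas.
\<close>

lemma quintic_symmetric_identity: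
  fixes x :: "nat \<Rightarrow> 'a::comm_ring_1" and G I J L M N P Q R S :: 'a
  assumes "A = I + 2*L + 2*N + P + 2*Q + 6*R + 4*S - 14"
    and "C = - G - I - J - 2*L - M - 2*P - 3*Q - 6*R - 7*S + 20"
    and "E = - I - 2*L - N - Q - 3*R - S + 5"
    and "F = 3*G - J - M + 6*N + 3*P + 3*Q + 12*R + 9*S - 30"
    and "H = - L - 2*N - P - Q - 4*R - 3*S + 10"
    and "K = - 2*G - 2*M - 2*N - 5*P - 2*Q - 6*R - 12*S + 30"
  shows "C * triple_sum x 2 =
      psum x 1 * (psum x 1 * (psum x 1 * (psum x 1 * psum x 1)))
    - A * psum x 5 - E * (psum x 1 * psum x 4) - F * (esym4 x * psum x 1)
    - G * (triple_sum x 1 * psum x 1) - H * (psum x 2 * psum x 3) - I * (psum x 3 * esym2 x)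
    - J * (esym3 x * psum x 2) - K * (esym3 x * esym2 x)
    - L * (psum x 3 * (psum x 1 * psum x 1)) - M * (esym3 x * (psum x 1 * psum x 1))
    - N * (psum x 2 * (psum x 2 * psum x 1)) - P * (esym2 x * (esym2 x * psum x 1))
    - Q * (psum x 2 * (esym2 x * psum x 1))
    - R * (psum x 2 * (psum x 1 * (psum x 1 * psum x 1)))
    - S * (esym2 x * (psum x 1 * (psum x 1 * psum x 1)))"
  unfolding assms triple_sum_1 triple_sum_2 newton_psum
  by (simp add: algebra_simps)

section \<open>The roots of the Tetranacci polynomial\<close>

text \<open>
  Vieta's formulas for four distinct roots, by divided differences: each difference of two
  vanishing polynomial values can be divided by the difference of the two roots, until the
  linear relation \<open>a + b + c + d = 1\<close> is left. The roots are grouped in two pairs because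
  \<open>prod_tetra_coeff\<close> computes with the sum and the product of each pair.
\<close>

lemma tetranacci_vieta:
  fixes a b c d :: complex
  assumes roots: "\<And>z. z \<in> {a, b, c, d} \<Longrightarrow> z ^ 4 - z ^ 3 - z ^ 2 - z - 1 = 0"
    and distinct: "a \<noteq> b" "a \<noteq> c" "a \<noteq> d" "b \<noteq> c" "b \<noteq> d" "c \<noteq> d"
  shows "a + b + c + d = 1"
    and "a*b + (a + b)*(c + d) + c*d = -1"
    and "a*b*(c + d) + (a + b)*(c*d) = 1"
    and "a*b*(c*d) = -1"
proof -
  \<comment> \<open>first and second divided differences of the Tetranacci polynomial\<close>
  define h2 where "h2 = (\<lambda>u v :: complex. u^3 + u^2*v + u*v^2 + v^3 - (u^2 + u*v + v^2) - (u + v) - 1)"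
  define h3 where "h3 = (\<lambda>u v w :: complex. u^2 + v^2 + w^2 + u*v + u*w + v*w - (u + v + w) - 1)"
  have p: "a ^ 4 - a ^ 3 - a ^ 2 - a - 1 = 0" "b ^ 4 - b ^ 3 - b ^ 2 - b - 1 = 0"
    "c ^ 4 - c ^ 3 - c ^ 2 - c - 1 = 0" "d ^ 4 - d ^ 3 - d ^ 2 - d - 1 = 0"
    using roots by auto
  have "(a - b) * h2 a b = 0" "(a - c) * h2 a c = 0" "(a - d) * h2 a d = 0"
    unfolding h2_def using p by algebra+
  then have h2: "h2 a b = 0" "h2 a c = 0" "h2 a d = 0"
    using distinct by auto
  have "(b - c) * h3 a b c = h2 a b - h2 a c" "(b - d) * h3 a b d = h2 a b - h2 a d"
    unfolding h2_def h3_def by algebra+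
  then have h3: "h3 a b c = 0" "h3 a b d = 0"
    using h2 distinct by auto
  have "(c - d) * (a + b + c + d - 1) = h3 a b c - h3 a b d"
    unfolding h3_def by algebra
  then have e1: "a + b + c + d - 1 = 0"
    using h3 distinct by auto
  then show "a + b + c + d = 1" by simp
  show e2: "a*b + (a + b)*(c + d) + c*d = -1"
    using h3(1) e1 unfolding h3_def by algebra
  show e3: "a*b*(c + d) + (a + b)*(c*d) = 1"
    using h2(1) e1 e2 unfolding h2_def by algebra
  show "a*b*(c*d) = -1"
    using p(1) e1 e2 e3 by algebra
qed

text \<open>
  The product of \<open>q z = - z\<^sup>3 + 6 z - 1\<close> over the four roots is, up to sign, a resultant. The
  values at two roots multiply to a polynomial \<open>r\<close> in the sum \<open>s\<close> and the product \<open>t\<close> of these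
  roots, so that only the two factors \<open>r s t\<close> and \<open>r s' t'\<close> remain, and
  the four Vieta relations between \<open>s, t, s', t'\<close> determine their product.
\<close>

lemma prod_tetra_coeff:
  fixes a b c d :: complex
  assumes roots: "\<And>z. z \<in> {a, b, c, d} \<Longrightarrow> z ^ 4 - z ^ 3 - z ^ 2 - z - 1 = 0"
    and distinct: "a \<noteq> b" "a \<noteq> c" "a \<noteq> d" "b \<noteq> c" "b \<noteq> d" "c \<noteq> d"
  shows "tetra_coeff a * tetra_coeff b * tetra_coeff c * tetra_coeff d = - 1 / 563"
proof -
  define q where "q = (\<lambda>z :: complex. - (z ^ 3) + 6 * z - 1)"
  define r where "r = (\<lambda>s t :: complex. t^3 - 6*t*(s^2 - 2*t) + s^3 - 3*s*t + 36*t - 6*s + 1)"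
  have pair: "q u * q v = r (u + v) (u * v)" for u v
    unfolding q_def r_def by algebra
  define s t s' t' where st: "s = a + b" "t = a * b" "s' = c + d" "t' = c * d"
  have "s + s' = 1" "t + s * s' + t' = -1" "t * s' + s * t' = 1" "t * t' = -1"
    using tetranacci_vieta[OF assms] unfolding st by (simp_all add: add.assoc)
  then have "r s t * r s' t' = - 563"
    unfolding r_def by algebra
  then have "q a * q b * (q c * q d) = - 563"
    unfolding pair st .
  moreover have "tetra_coeff z = 1 / q z" for z
    by (simp add: tetra_coeff_def q_def)
  ultimately show ?thesis
    by (simp add: mult.assoc)
qed

section \<open>The exponential terms\<close>

definition exp_term :: "(nat \<Rightarrow> complex) \<Rightarrow> nat \<Rightarrow> nat \<Rightarrow> complex fps" where
  "exp_term lam n i = fps_const (tetra_coeff (lam i) ^ n) * fps_exp (lam i)"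

lemma exp_term_power:
  "exp_term lam n i ^ r = fps_const (tetra_coeff (lam i) ^ (r * n)) * fps_exp (of_nat r * lam i)"
  by (simp add: exp_term_def power_mult_distrib fps_exp_power_mult fps_const_power
      mult.commute[of r n] power_mult)

lemma sum_1_to_4: "(\<Sum>i=1..4. f i) = f 1 + f 2 + f 3 + f (4 :: nat)"
  for f :: "nat \<Rightarrow> 'a::comm_monoid_add"
proof -
  have "{1..4} = {1, 2, 3, 4 :: nat}" by auto
  then show ?thesis by (simp add: add_ac)
qed

lemma egf_coeff_psum_exp_term:
  assumes "tetranacci_rep (U_egf lam (r * n)) A u"
  shows "egf_coeff (psum (exp_term lam n) r) m = of_nat r ^ m * of_int (u m) / of_rat A"
proof -
  have "egf_coeff (psum (exp_term lam n) r) m = of_nat r ^ m * egf_coeff (U_egf lam (r * n)) m"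
    unfolding psum_def exp_term_power U_egf_def egf_coeff_sum egf_coeff_add egf_coeff_const_mult
      egf_coeff_exp sum_1_to_4
    by (simp add: power_mult_distrib algebra_simps)
  also have "egf_coeff (U_egf lam (r * n)) m = of_int (u m) / of_rat A"
    using assms by (simp add: tetranacci_rep_def egf_coeff_const_mult egf_coeff_egf)
  finally show ?thesis by simp
qed

lemma t2_eq_triple_sum: "t2 lam n = egf_coeff (triple_sum (exp_term lam n) 1)"
  unfolding t2_def triple_sum_def exp_term_def Let_def
  by (simp add: fps_exp_add_mult fps_const_mult[symmetric] mult_ac del: fps_const_mult)

lemma t4_eq_triple_sum: "t4 lam n = egf_coeff (triple_sum (exp_term lam n) 2)"
  unfolding t4_def triple_sum_def exp_term_power Let_def
  unfolding exp_term_def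
  by (simp add: fps_exp_add_mult fps_const_mult[symmetric] mult_ac del: fps_const_mult)

lemma egf_coeff_esym2_exp_term:
  assumes "tetranacci_rep (U_egf lam n) (A1 n) (U n)"
    and "tetranacci_rep (U_egf lam (2 * n)) (A1 (2 * n)) (U (2 * n))"
  shows "egf_coeff (esym2 (exp_term lam n)) m = t1 A1 U n m"
proof -
  let ?x = "exp_term lam n"
  have p1: "egf_coeff (psum ?x 1) k = of_int (U n k) / of_rat (A1 n)" for k
    using egf_coeff_psum_exp_term[of lam 1 n] assms(1) by simp
  have p2: "egf_coeff (psum ?x 2) k = 2 ^ k * of_int (U (2 * n) k) / of_rat (A1 (2 * n))" for k
    using egf_coeff_psum_exp_term[of lam 2 n] assms(2) by simp
  have "fps_const 2 * esym2 ?x = psum ?x 1 * psum ?x 1 - psum ?x 2"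
    using newton_psum(1)[of ?x] by (simp flip: numeral_fps_const)
  then have "2 * egf_coeff (esym2 ?x) m = egf_coeff (psum ?x 1 * psum ?x 1) m - egf_coeff (psum ?x 2) m"
    by (metis egf_coeff_const_mult egf_coeff_diff)
  then show ?thesis
    unfolding t1_def egf_coeff_mult_2 p1 p2
    by (simp add: sum_distrib_left field_simps power2_eq_square)
qed

text \<open>
  The generating function of \<open>V\<close> with \<open>X\<close> replaced by \<open>- X\<close>. This reflection is the source of the
  signs \<open>(-1)\<^sup>k\<close> in the theorem.
\<close>

definition reflected_V_egf :: "(nat \<Rightarrow> complex) \<Rightarrow> nat \<Rightarrow> complex fps" where
  "reflected_V_egf lam n =
     (\<Sum>i=1..4. fps_const (\<Prod>j\<in>{1..4} - {i}. tetra_coeff (lam j) ^ n) * fps_exp (- lam i))"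

lemma egf_coeff_reflected_V_egf:
  assumes "tetranacci_rep (V_egf lam n) A v"
  shows "egf_coeff (reflected_V_egf lam n) m = (-1) ^ m * of_int (v m) / of_rat A"
proof -
  have "egf_coeff (reflected_V_egf lam n) m = (-1) ^ m * egf_coeff (V_egf lam n) m"
    unfolding reflected_V_egf_def V_egf_def egf_coeff_sum egf_coeff_const_mult egf_coeff_exp
    by (simp add: sum_distrib_left mult_ac power_minus[of "lam _"])
  also have "egf_coeff (V_egf lam n) m = of_int (v m) / of_rat A"
    using assms by (simp add: tetranacci_rep_def egf_coeff_const_mult egf_coeff_egf)
  finally show ?thesis by simp
qed

text \<open>
  Since the roots have sum \<open>1\<close>, \<open>\<lambda>\<^sub>i + \<lambda>\<^sub>j + \<lambda>\<^sub>l\<close> equals \<open>1 - \<lambda>\<^sub>k\<close> for the remaining index \<open>k\<close>. The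
  factor \<open>exp X\<close> is the exponential generating function of the constant sequence \<open>1\<close>, hence
  the last index of the corresponding sums
  in the theorem carries no sequence.
\<close>

lemma esym3_exp_term:
  assumes sum1: "lam 1 + lam 2 + lam 3 + lam 4 = 1"
  shows "esym3 (exp_term lam n) = reflected_V_egf lam n * fps_exp 1"
proof -
  have erase: "{1..4} - {1} = {2, 3, 4 :: nat}" "{1..4} - {2} = {1, 3, 4 :: nat}"
    "{1..4} - {3} = {1, 2, 4 :: nat}" "{1..4} - {4} = {1, 2, 3 :: nat}"
    by auto
  have three: "fps_const a * fps_exp u * (fps_const b * fps_exp v) * (fps_const c * fps_exp w)
      = fps_const (a * b * c) * fps_exp (- z) * fps_exp 1"
    if "u + v + w + z = 1" for a b c u v w z :: complex
  proof -
    have "fps_exp (- z) * fps_exp 1 = fps_exp u * fps_exp v * fps_exp w"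
      unfolding fps_exp_add_mult[symmetric] using that by (simp add: algebra_simps)
    then show ?thesis
      by (simp add: fps_const_mult[symmetric] mult_ac del: fps_const_mult)
  qed
  have "esym3 (exp_term lam n) =
      (fps_const (tetra_coeff (lam 1) ^ n * tetra_coeff (lam 2) ^ n * tetra_coeff (lam 3) ^ n)
         * fps_exp (- lam 4)
       + fps_const (tetra_coeff (lam 1) ^ n * tetra_coeff (lam 2) ^ n * tetra_coeff (lam 4) ^ n)
         * fps_exp (- lam 3)
       + fps_const (tetra_coeff (lam 1) ^ n * tetra_coeff (lam 3) ^ n * tetra_coeff (lam 4) ^ n)
         * fps_exp (- lam 2)
       + fps_const (tetra_coeff (lam 2) ^ n * tetra_coeff (lam 3) ^ n * tetra_coeff (lam 4) ^ n)
         * fps_exp (- lam 1)) * fps_exp 1"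
    unfolding esym3_def exp_term_def distrib_right
    using sum1 by (intro arg_cong2[where f = "(+)"] three) (simp_all add: algebra_simps)
  also have "\<dots> = reflected_V_egf lam n * fps_exp 1"
    unfolding reflected_V_egf_def sum_1_to_4 erase by (simp add: mult_ac add_ac)
  finally show ?thesis .
qed

lemma esym4_exp_term:
  assumes sum1: "lam 1 + lam 2 + lam 3 + lam 4 = 1"
    and "tetra_coeff (lam 1) * tetra_coeff (lam 2) * tetra_coeff (lam 3) * tetra_coeff (lam 4)
           = - 1 / 563"
  shows "esym4 (exp_term lam n) = fps_const ((- 1 / 563) ^ n) * fps_exp 1"
proof -
  have "fps_exp 1 = fps_exp (lam 1) * fps_exp (lam 2) * fps_exp (lam 3) * fps_exp (lam 4)"
    unfolding sum1[symmetric] fps_exp_add_mult ..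
  then show ?thesis
    unfolding assms(2)[symmetric] esym4_def exp_term_def
    by (simp add: power_mult_distrib fps_const_mult[symmetric] mult_ac del: fps_const_mult)
qed

section \<open>The convolution identity\<close>

theorem theorem18:
  fixes lam :: "nat \<Rightarrow> complex"
    and A1 A2 :: "nat \<Rightarrow> rat"
    and U V :: "nat \<Rightarrow> nat \<Rightarrow> int"
    and A C E F G H I J K L M N P Q R S :: complex
    and m n :: nat
  assumes roots: "bij_betw lam {1..4} {z. z ^ 4 - z ^ 3 - z ^ 2 - z - 1 = 0}"
    and U: "\<And>r. r \<ge> 1 \<Longrightarrow> tetranacci_rep (U_egf lam r) (A1 r) (U r)"
    and V: "\<And>r. r \<ge> 1 \<Longrightarrow> tetranacci_rep (V_egf lam r) (A2 r) (V r)"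
    and A: "A = I + 2*L + 2*N + P + 2*Q + 6*R + 4*S - 14"
    and C: "C = - G - I - J - 2*L - M - 2*P - 3*Q - 6*R - 7*S + 20"
    and E: "E = - I - 2*L - N - Q - 3*R - S + 5"
    and F: "F = 3*G - J - M + 6*N + 3*P + 3*Q + 12*R + 9*S - 30"
    and H: "H = - L - 2*N - P - Q - 4*R - 3*S + 10"
    and K: "K = - 2*G - 2*M - 2*N - 5*P - 2*Q - 6*R - 12*S + 30"
    and C_nz: "C \<noteq> 0"
    and n: "n \<ge> 1"
  shows "C * t4 lam n m =
      1 / of_rat (A1 n) ^ 5 *
        (\<Sum>(k1, k2, k3, k4, k5) | k1 + k2 + k3 + k4 + k5 = m. multinom m [k1, k2, k3, k4, k5] *
           of_int (U n k1) * of_int (U n k2) * of_int (U n k3) * of_int (U n k4) * of_int (U n k5))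
    - A / of_rat (A1 (5 * n)) * 5 ^ m * of_int (U (5 * n) m)
    - E / (of_rat (A1 (4 * n)) * of_rat (A1 n)) *
        (\<Sum>k=0..m. of_nat (m choose k) * 4 ^ (m - k) *
           of_int (U (4 * n) (m - k)) * of_int (U n k))
    - F / of_rat (A1 n) * (- 1 / 563) ^ n *
        (\<Sum>k=0..m. of_nat (m choose k) * of_int (U n k))
    - G / of_rat (A1 n) *
        (\<Sum>k=0..m. of_nat (m choose k) * t2 lam n k * of_int (U n (m - k)))
    - H / (of_rat (A1 (3 * n)) * of_rat (A1 (2 * n))) *
        (\<Sum>k=0..m. of_nat (m choose k) * 3 ^ (m - k) * 2 ^ k *
           of_int (U (3 * n) (m - k)) * of_int (U (2 * n) k))
    - I / of_rat (A1 (3 * n)) *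
        (\<Sum>k=0..m. of_nat (m choose k) * 3 ^ k * of_int (U (3 * n) k) * t1 A1 U n (m - k))
    - J / (of_rat (A2 n) * of_rat (A1 (2 * n))) *
        (\<Sum>(k1, k2, k3) | k1 + k2 + k3 = m. multinom m [k1, k2, k3] *
           (- 1) ^ k1 * of_int (V n k1) * 2 ^ k2 * of_int (U (2 * n) k2))
    - K / of_rat (A2 n) *
        (\<Sum>(k1, k2, k3) | k1 + k2 + k3 = m. multinom m [k1, k2, k3] *
           (- 1) ^ k1 * of_int (V n k1) * t1 A1 U n k2)
    - L / (of_rat (A1 (3 * n)) * of_rat (A1 n) ^ 2) *
        (\<Sum>(k1, k2, k3) | k1 + k2 + k3 = m. multinom m [k1, k2, k3] *
           3 ^ k1 * of_int (U (3 * n) k1) * of_int (U n k2) * of_int (U n k3))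
    - M / (of_rat (A2 n) * of_rat (A1 n) ^ 2) *
        (\<Sum>(k1, k2, k3, k4) | k1 + k2 + k3 + k4 = m. multinom m [k1, k2, k3, k4] *
           (- 1) ^ k1 * of_int (V n k1) * of_int (U n k2) * of_int (U n k3))
    - N / (of_rat (A1 (2 * n)) ^ 2 * of_rat (A1 n)) *
        (\<Sum>(k1, k2, k3) | k1 + k2 + k3 = m. multinom m [k1, k2, k3] *
           2 ^ k1 * of_int (U (2 * n) k1) * 2 ^ k2 * of_int (U (2 * n) k2) * of_int (U n k3))
    - P / of_rat (A1 n) *
        (\<Sum>(k1, k2, k3) | k1 + k2 + k3 = m. multinom m [k1, k2, k3] *
           t1 A1 U n k1 * t1 A1 U n k2 * of_int (U n k3))
    - Q / (of_rat (A1 (2 * n)) * of_rat (A1 n)) *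
        (\<Sum>(k1, k2, k3) | k1 + k2 + k3 = m. multinom m [k1, k2, k3] *
           2 ^ k1 * of_int (U (2 * n) k1) * t1 A1 U n k2 * of_int (U n k3))
    - R / (of_rat (A1 (2 * n)) * of_rat (A1 n) ^ 3) *
        (\<Sum>(k1, k2, k3, k4) | k1 + k2 + k3 + k4 = m. multinom m [k1, k2, k3, k4] *
           2 ^ k1 * of_int (U (2 * n) k1) * of_int (U n k2) * of_int (U n k3) * of_int (U n k4))
    - S / of_rat (A1 n) ^ 3 *
        (\<Sum>(k1, k2, k3, k4) | k1 + k2 + k3 + k4 = m. multinom m [k1, k2, k3, k4] *
           t1 A1 U n k1 * of_int (U n k2) * of_int (U n k3) * of_int (U n k4))"
proof -
  let ?x = "exp_term lam n"
  have root: "lam i ^ 4 - lam i ^ 3 - lam i ^ 2 - lam i - 1 = 0" if "i \<in> {1..4}" for i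
    using roots that by (auto simp: bij_betw_def)
  have "lam i \<noteq> lam j" if "i \<in> {1..4}" "j \<in> {1..4}" "i \<noteq> j" for i j
    using roots that by (auto simp: bij_betw_def inj_on_def)
  then have distinct: "lam 1 \<noteq> lam 2" "lam 1 \<noteq> lam 3" "lam 1 \<noteq> lam 4"
    "lam 2 \<noteq> lam 3" "lam 2 \<noteq> lam 4" "lam 3 \<noteq> lam 4"
    by simp_all
  have root4: "z ^ 4 - z ^ 3 - z ^ 2 - z - 1 = 0" if "z \<in> {lam 1, lam 2, lam 3, lam 4}" for z
    using that root[of 1] root[of 2] root[of 3] root[of 4] by auto
  have sum1: "lam 1 + lam 2 + lam 3 + lam 4 = 1"
    using tetranacci_vieta(1)[OF root4 distinct] .
  have e3: "esym3 ?x = reflected_V_egf lam n * fps_exp 1"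
    by (rule esym3_exp_term[OF sum1])
  have e4: "esym4 ?x = fps_const ((- 1 / 563) ^ n) * fps_exp 1"
    by (rule esym4_exp_term[OF sum1 prod_tetra_coeff[OF root4 distinct]])
  have p: "egf_coeff (psum ?x r) k = of_nat r ^ k * of_int (U (r * n) k) / of_rat (A1 (r * n))"
    if "r \<ge> 1" for r k
    using that n by (intro egf_coeff_psum_exp_term U) simp
  have p1: "egf_coeff (psum ?x 1) k = of_int (U n k) / of_rat (A1 n)" for k
    using p[of 1] by simp
  note ps = p[of 2, simplified] p[of 3, simplified] p[of 4, simplified] p[of 5, simplified]
  have e2: "egf_coeff (esym2 ?x) k = t1 A1 U n k" for k
    using n by (intro egf_coeff_esym2_exp_term U) simp_all
  have v: "egf_coeff (reflected_V_egf lam n) k = (-1) ^ k * of_int (V n k) / of_rat (A2 n)" for k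
    using n by (intro egf_coeff_reflected_V_egf V) simp
  note coeffs = p1 ps e2 v egf_coeff_exp t2_eq_triple_sum[symmetric]
  have params:
    "fps_const A = fps_const I + 2*fps_const L + 2*fps_const N + fps_const P + 2*fps_const Q
       + 6*fps_const R + 4*fps_const S - 14"
    "fps_const C = - fps_const G - fps_const I - fps_const J - 2*fps_const L - fps_const M
       - 2*fps_const P - 3*fps_const Q - 6*fps_const R - 7*fps_const S + 20"
    "fps_const E = - fps_const I - 2*fps_const L - fps_const N - fps_const Q - 3*fps_const R
       - fps_const S + 5"
    "fps_const F = 3*fps_const G - fps_const J - fps_const M + 6*fps_const N + 3*fps_const P
       + 3*fps_const Q + 12*fps_const R + 9*fps_const S - 30"
    "fps_const H = - fps_const L - 2*fps_const N - fps_const P - fps_const Q - 4*fps_const R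
       - 3*fps_const S + 10"
    "fps_const K = - 2*fps_const G - 2*fps_const M - 2*fps_const N - 5*fps_const P
       - 2*fps_const Q - 6*fps_const R - 12*fps_const S + 30"
    by (simp_all add: A C E F H K numeral_fps_const)
  have main: "C * egf_coeff (triple_sum ?x 2) m =
      egf_coeff (psum ?x 1 * (psum ?x 1 * (psum ?x 1 * (psum ?x 1 * psum ?x 1)))) m
    - A * egf_coeff (psum ?x 5) m - E * egf_coeff (psum ?x 1 * psum ?x 4) m
    - F * egf_coeff (esym4 ?x * psum ?x 1) m - G * egf_coeff (triple_sum ?x 1 * psum ?x 1) m
    - H * egf_coeff (psum ?x 2 * psum ?x 3) m - I * egf_coeff (psum ?x 3 * esym2 ?x) m
    - J * egf_coeff (esym3 ?x * psum ?x 2) m - K * egf_coeff (esym3 ?x * esym2 ?x) m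
    - L * egf_coeff (psum ?x 3 * (psum ?x 1 * psum ?x 1)) m
    - M * egf_coeff (esym3 ?x * (psum ?x 1 * psum ?x 1)) m
    - N * egf_coeff (psum ?x 2 * (psum ?x 2 * psum ?x 1)) m
    - P * egf_coeff (esym2 ?x * (esym2 ?x * psum ?x 1)) m
    - Q * egf_coeff (psum ?x 2 * (esym2 ?x * psum ?x 1)) m
    - R * egf_coeff (psum ?x 2 * (psum ?x 1 * (psum ?x 1 * psum ?x 1))) m
    - S * egf_coeff (esym2 ?x * (psum ?x 1 * (psum ?x 1 * psum ?x 1))) m"
    using arg_cong[OF quintic_symmetric_identity[OF params, of ?x], of "\<lambda>f. egf_coeff f m"]
    unfolding egf_coeff_diff egf_coeff_const_mult .
  \<comment> \<open>The factor \<open>exp X\<close> is moved to the end, so that it supplies the last index of each convolution.\<close>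
  have exp_last:
    "esym3 ?x * psum ?x 2 = reflected_V_egf lam n * (psum ?x 2 * fps_exp 1)"
    "esym3 ?x * esym2 ?x = reflected_V_egf lam n * (esym2 ?x * fps_exp 1)"
    "esym3 ?x * (psum ?x 1 * psum ?x 1)
       = reflected_V_egf lam n * (psum ?x 1 * (psum ?x 1 * fps_exp 1))"
    "esym4 ?x * psum ?x 1 = fps_const ((- 1 / 563) ^ n) * (psum ?x 1 * fps_exp 1)"
    unfolding e3 e4 by (simp_all add: mult_ac)
  have pow5: "z ^ 5 = z * z * z * z * z" for z :: complex
    by (simp add: eval_nat_numeral)
  \<comment> \<open>The sums over longer tuples come first, since a product of four or five factors also matches
    the convolution rules for fewer factors.\<close>
  show ?thesis
    unfolding t4_eq_triple_sum main exp_last egf_coeff_const_mult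
    unfolding egf_coeff_mult_5 unfolding egf_coeff_mult_4
    unfolding egf_coeff_mult_3 unfolding egf_coeff_mult_2
    unfolding coeffs sum_distrib_left
    by (intro arg_cong2[where f = "(-)"];
        (intro sum.cong refl)?;
        simp only: case_prod_unfold divide_inverse inverse_mult_distrib power2_eq_square
          power3_eq_cube pow5 power_one mult_1_left mult_1_right mult_ac)
qed

end
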